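(* Let $\psi$ be the real root of $x^3=x^2+x+1$. For all integers $n\ge0$, $$\lfloor\psi n\rfloor-1\le A_n\le\lfloor\psi n\rfloor+1,$$ $$\lfloor\psi^2n\rfloor-2\le B_n\le\lfloor\psi^2n\rfloor+1,$$ $$\lfloor\psi^3n\rfloor-3\le C_n\le\lfloor\psi^3n\rfloor+1.$$
   Context: The Tribonacci word $\mathbf T=t_1t_2t_3\cdots$ (indexed from $1$) is the infinite fixed point, beginning with $a$, of the morphism $\tau: a\to ab,\ b\to ac,\ c\to a$. For $n\ge1$, $A_n$ (resp. $B_n$, $C_n$) is the index of the $n$th occurrence of the letter $a$ (resp. $b$, $c$) in $\mathbf T$; also $A_0=B_0=C_0=0$. *)

theory Defs
  imports Complex_Main "HOL-Library.Stream" "HOL-Library.Infinite_Set"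
begin

datatype letter = LetA | LetB | LetC

fun trib_morph :: "letter \<Rightarrow> letter list" where
  "trib_morph LetA = [LetA, LetB]"
| "trib_morph LetB = [LetA, LetC]"
| "trib_morph LetC = [LetA]"

text \<open>Extension of the morphism to infinite words; \<open>flat\<close> is well behaved here because
  the morphism is non-erasing.\<close>

definition trib_subst :: "letter stream \<Rightarrow> letter stream" where
  "trib_subst w = flat (smap trib_morph w)"

definition trib_word :: "letter stream" where
  "trib_word = (THE w. shd w = LetA \<and> trib_subst w = w)"

text \<open>Streams are indexed from 0, the letters of the word from 1, hence the shift.
  The enumeration also starts from 0: its entry with index \<open>n - 1\<close> is the \<open>n\<close>-th smallest
  element. It is total, but meaningful because every letter occurs infinitely often
  (lemma \<open>infinite_trib_occ\<close> below).\<close>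

definition trib_occ :: "letter \<Rightarrow> nat set" where
  "trib_occ x = {i. 1 \<le> i \<and> trib_word !! (i - 1) = x}"

definition trib_pos :: "letter \<Rightarrow> nat \<Rightarrow> nat" where
  "trib_pos x n = (if n = 0 then 0 else enumerate (trib_occ x) (n - 1))"

definition A_pos :: "nat \<Rightarrow> nat" where "A_pos = trib_pos LetA"
definition B_pos :: "nat \<Rightarrow> nat" where "B_pos = trib_pos LetB"
definition C_pos :: "nat \<Rightarrow> nat" where "C_pos = trib_pos LetC"


subsection \<open>The definitions are meaningful\<close>

definition trib_iter :: "nat \<Rightarrow> letter list" where
  "trib_iter k = ((\<lambda>u. concat (map trib_morph u)) ^^ k) [LetA]"

lemma trib_iter_0: "trib_iter 0 = [LetA]"
  and trib_iter_Suc: "trib_iter (Suc k) = concat (map trib_morph (trib_iter k))"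
  by (simp_all add: trib_iter_def)

lemma trib_morph_ne: "trib_morph x \<noteq> []"
  by (cases x) auto

lemma trib_subst_shift:
  "trib_subst (u @- s) = concat (map trib_morph u) @- trib_subst s"
  by (induct u) (auto simp: trib_subst_def trib_morph_ne)

lemma sset_trib_subst: "sset (trib_subst s) = (\<Union>x\<in>sset s. set (trib_morph x))"
  unfolding trib_subst_def by (subst sset_flat) (auto simp: stream.set_map trib_morph_ne)

lemma trib_iter_append: "\<exists>r. r \<noteq> [] \<and> trib_iter (Suc k) = trib_iter k @ r"
proof (induct k)
  case 0
  show ?case by (simp add: trib_iter_Suc trib_iter_0)
next
  case (Suc k)
  then obtain r where r: "r \<noteq> []" "trib_iter (Suc k) = trib_iter k @ r" by blast
  have "trib_iter (Suc (Suc k)) = trib_iter (Suc k) @ concat (map trib_morph r)"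
    by (metis r(2) trib_iter_Suc map_append concat_append)
  moreover have "concat (map trib_morph r) \<noteq> []"
    using r(1) by (cases r) (auto simp: trib_morph_ne)
  ultimately show ?case by blast
qed

lemma trib_iter_length: "k < length (trib_iter k)"
proof (induct k)
  case (Suc k)
  obtain r where "r \<noteq> []" "trib_iter (Suc k) = trib_iter k @ r"
    using trib_iter_append by blast
  then show ?case using Suc by (cases r) auto
qed (simp add: trib_iter_0)

lemma trib_iter_nth:
  assumes "j \<le> k" "i < length (trib_iter j)"
  shows "i < length (trib_iter k) \<and> trib_iter k ! i = trib_iter j ! i"
  using assms(1)
proof (induct k rule: dec_induct)
  case (step k)
  obtain r where "trib_iter (Suc k) = trib_iter k @ r"
    using trib_iter_append by blast
  then show ?case using step by (auto simp: nth_append)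
qed (use assms(2) in auto)

lemma fixed_point_shift:
  assumes "shd w = LetA" "trib_subst w = w"
  shows "w = trib_iter k @- (trib_subst ^^ k) (stl w)"
proof (induct k)
  case 0
  show ?case using assms(1) by (simp add: trib_iter_0) (metis stream.collapse)
next
  case (Suc k)
  then have "trib_subst w = trib_iter (Suc k) @- (trib_subst ^^ Suc k) (stl w)"
    by (metis trib_subst_shift trib_iter_Suc funpow.simps(2) comp_apply)
  then show ?case using assms(2) by simp
qed

lemma ex1_trib_word: "\<exists>!w. shd w = LetA \<and> trib_subst w = w"
proof (rule ex_ex1I)
  define w where "w = smap (\<lambda>n. trib_iter n ! n) nats"
  have nth: "w !! n = trib_iter n ! n" for n
    by (simp add: w_def)
  have st: "stake (length (trib_iter k)) w = trib_iter k" for k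
  proof (rule nth_equalityI)
    fix i assume "i < length (stake (length (trib_iter k)) w)"
    then have i: "i < length (trib_iter k)" by simp
    have "trib_iter i ! i = trib_iter k ! i"
      using trib_iter_nth[of i k i] trib_iter_nth[of k i i] i trib_iter_length[of i]
      by (cases "i \<le> k") auto
    then show "stake (length (trib_iter k)) w ! i = trib_iter k ! i"
      using i by (simp add: nth)
  qed simp
  have "trib_subst w !! k = w !! k" for k
  proof -
    have "trib_subst w = trib_iter (Suc k) @- trib_subst (sdrop (length (trib_iter k)) w)"
      by (metis st stake_sdrop trib_subst_shift trib_iter_Suc)
    moreover have "k < length (trib_iter (Suc k)) \<and> trib_iter (Suc k) ! k = trib_iter k ! k"
      using trib_iter_nth[of k "Suc k" k] trib_iter_length[of k] by simp
    ultimately show ?thesis by (simp add: nth)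
  qed
  then have "smap ((!!) (trib_subst w)) nats = smap ((!!) w) nats"
    by presburger
  then have "trib_subst w = w"
    by (metis stream_smap_nats)
  moreover have "shd w = LetA"
    using nth[of 0] by (simp add: trib_iter_0)
  ultimately show "\<exists>w. shd w = LetA \<and> trib_subst w = w" by blast
next
  fix v w :: "letter stream"
  assume v: "shd v = LetA \<and> trib_subst v = v" and w: "shd w = LetA \<and> trib_subst w = w"
  have "v !! k = w !! k" for k
    using fixed_point_shift[of v k] fixed_point_shift[of w k] v w trib_iter_length[of k]
    by (metis shift_snth_less)
  then have "smap ((!!) v) nats = smap ((!!) w) nats"
    by presburger
  then show "v = w" by (metis stream_smap_nats)
qed

lemma shd_trib_word: "shd trib_word = LetA"
  and trib_subst_trib_word: "trib_subst trib_word = trib_word"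
  using theI'[OF ex1_trib_word] by (simp_all add: trib_word_def)

lemma infinite_trib_occ: "infinite (trib_occ x)"
proof -
  have w: "trib_word = trib_iter k @- (trib_subst ^^ k) (stl trib_word)" for k
    by (rule fixed_point_shift[OF shd_trib_word trib_subst_trib_word])
  have "trib_iter 3 = [LetA, LetB, LetA, LetC, LetA, LetB, LetA]"
    by (simp add: trib_iter_Suc trib_iter_0 numeral_3_eq_3)
  then have "stl trib_word = [LetB, LetA, LetC, LetA, LetB, LetA] @-
      (trib_subst ^^ 3) (stl trib_word)"
    using arg_cong[OF w[of 3], of stl] by simp
  then have base: "{LetA, LetB, LetC} \<subseteq> sset (stl trib_word)"
    by (metis insert_subset list.set(2) sset_shift Un_iff empty_subsetI insertCI)
  have "{LetA, LetB, LetC} \<subseteq> sset ((trib_subst ^^ k) (stl trib_word))" for k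
  proof (induct k)
    case 0
    show ?case using base by simp
  next
    case (Suc k)
    then show ?case
      by (force simp: sset_trib_subst)
  qed
  then have tail: "x \<in> sset ((trib_subst ^^ k) (stl trib_word))" for k
    by (cases x) auto
  have "\<exists>i>k. i \<in> trib_occ x" for k
  proof -
    obtain j where "(trib_subst ^^ k) (stl trib_word) !! j = x"
      using tail[of k] by (auto simp: sset_range)
    then have "trib_word !! (length (trib_iter k) + j) = x"
      by (subst w[of k]) simp
    then have "Suc (length (trib_iter k) + j) \<in> trib_occ x"
      by (simp add: trib_occ_def)
    then show ?thesis using trib_iter_length[of k] by (intro exI[of _ "Suc (length (trib_iter k) + j)"]) simp
  qed
  then show ?thesis
    by (simp add: infinite_nat_iff_unbounded)
qed

lemma ex1_real_root: "\<exists>!x::real. x ^ 3 = x ^ 2 + x + 1"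
proof (rule ex_ex1I)
  have "\<exists>x::real. 1 \<le> x \<and> x \<le> 2 \<and> x ^ 3 - x ^ 2 - x - 1 = 0"
    by (rule IVT) (auto intro!: continuous_intros)
  then show "\<exists>x::real. x ^ 3 = x ^ 2 + x + 1"
    by (auto simp: algebra_simps)
next
  have gt1: "1 < x" if "x ^ 3 = x ^ 2 + x + 1" for x :: real
  proof (rule ccontr)
    assume "\<not> 1 < x"
    have e: "x ^ 2 * (x - 1) = x + 1"
      using that by (simp add: algebra_simps power2_eq_square power3_eq_cube)
    show False
    proof (cases "-1 < x")
      case True
      have "x ^ 2 * (x - 1) \<le> 0"
        using \<open>\<not> 1 < x\<close> by (intro mult_nonneg_nonpos) auto
      then show False using e True by linarith
    next
      case False
      then have "1 \<le> x ^ 2" using abs_le_square_iff[of 1 x] by simp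
      then have "x ^ 2 * (x - 1) \<le> 1 * (x - 1)"
        using False by (intro mult_right_mono_neg) auto
      then show False unfolding e by simp
    qed
  qed
  fix x y :: real
  assume x: "x ^ 3 = x ^ 2 + x + 1" and y: "y ^ 3 = y ^ 2 + y + 1"
  have "(x - y) * (x * (x - 1) + y * (y - 1) + (x * y - 1)) = 0"
    using x y by (simp add: algebra_simps power2_eq_square power3_eq_cube)
  moreover have "x * (x - 1) + y * (y - 1) + (x * y - 1) > 0"
  proof -
    have "0 < x * (x - 1)" "0 < y * (y - 1)" "1 < x * y"
      using gt1[OF x] gt1[OF y] by (auto intro: less_1_mult)
    then show ?thesis by linarith
  qed
  ultimately show "x = y" by simp
qed

end

theory Submission
  imports Defs
begin

text \<open>
  Let \<open>n \<ge> 1\<close> and let \<open>p\<close> be the prefix of length \<open>n - 1\<close> of the Tribonacci word. For every letter \<open>y\<close>, the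
  words \<open>\<tau>(y)\<close>, \<open>\<tau>\<^sup>2(y)\<close> and \<open>\<tau>\<^sup>3(y)\<close> contain exactly one \<open>a\<close>, one \<open>b\<close> and one \<open>c\<close>, at the
  positions 1, 2 and 4 respectively. As the word is fixed by \<open>\<tau>\<^sup>k\<close>, it follows that
  \<open>A\<^sub>n = |\<tau>(p)| + 1\<close>, \<open>B\<^sub>n = |\<tau>\<^sup>2(p)| + 2\<close> and \<open>C\<^sub>n = |\<tau>\<^sup>3(p)| + 4\<close> (lemmas \<open>A_pos_Suc\<close>,
  \<open>B_pos_Suc\<close>, \<open>C_pos_Suc\<close>). It remains to bound \<open>|\<tau>\<^sup>k(p)| - \<psi>\<^sup>k |p|\<close> for \<open>k = 1, 2, 3\<close>.

  Each of these is the value at \<open>p\<close> of a linear functional \<open>f\<close> of the letter counts. Every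
  nonempty prefix is \<open>\<tau>(q)\<close> or \<open>\<tau>(q)a\<close> for a shorter prefix \<open>q\<close> (lemma
  \<open>trib_prefix_desubst\<close>), so repeated desubstitution gives
  \<open>f(p) = e\<^sub>0 d\<^sub>0 + \<dots> + e\<^sub>9 d\<^sub>9 + f(\<tau>\<^sup>1\<^sup>0(r))\<close> with \<open>d\<^sub>j = f(\<tau>\<^sup>j(a))\<close>, digits \<open>e\<^sub>j \<in> {0, 1}\<close> and a
  prefix \<open>r\<close>. The functional vanishes on the vector of letter frequencies, so only the two
  contracting eigenvalues of the incidence matrix matter: the values \<open>f(\<tau>\<^sup>j(r))\<close> satisfy a linear
  recurrence of order two, along which a positive definite quadratic form is divided by \<open>\<psi>\<close>
  (lemma \<open>qf_contract\<close>). Appending a letter \<open>a\<close> adds a constant vector, so the form is bounded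
  on all prefixes (lemma \<open>qf_lin_trib_prefix\<close>), and ten further contractions leave a remainder
  \<open>f(\<tau>\<^sup>1\<^sup>0(r))\<close> of absolute value at most \<open>0.4\<close> for the three functionals. The digit sum lies
  between the sum of the negative and the sum of the positive numbers among \<open>d\<^sub>0, \<dots>, d\<^sub>9\<close>;
  evaluating these two sums gives bounds that are sharp enough.
\<close>

section \<open>Block structure of the word\<close>

text \<open>The morphism \<open>\<tau>\<close> on finite words.\<close>

definition trib_image :: "letter list \<Rightarrow> letter list" where
  "trib_image u = concat (map trib_morph u)"

lemma trib_image_append: "trib_image (u @ v) = trib_image u @ trib_image v"
  by (simp add: trib_image_def)

lemma trib_image_funpow_append: "(trib_image ^^ k) (u @ v) = (trib_image ^^ k) u @ (trib_image ^^ k) v"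
  by (induct k) (simp_all add: trib_image_append)

lemma length_trib_image: "length u \<le> length (trib_image u)"
proof (induct u)
  case (Cons x u)
  then show ?case by (cases x) (auto simp: trib_image_def)
qed (simp add: trib_image_def)

lemma length_trib_image_funpow: "length u \<le> length ((trib_image ^^ k) u)"
  by (induct k) (auto intro: order_trans length_trib_image)

abbreviation trib_prefix :: "nat \<Rightarrow> letter list" where
  "trib_prefix n \<equiv> stake n trib_word"

lemma trib_subst_funpow_shift:
  "(trib_subst ^^ k) (u @- s) = (trib_image ^^ k) u @- (trib_subst ^^ k) s"
  by (induct k) (simp_all add: trib_subst_shift trib_image_def)

lemma trib_word_split:
  "trib_word = (trib_image ^^ k) (trib_prefix m) @- (trib_subst ^^ k) (sdrop m trib_word)"
proof -
  have "(trib_subst ^^ k) trib_word = trib_word"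
    by (induct k) (simp_all add: trib_subst_trib_word)
  then show ?thesis
    by (metis stake_sdrop trib_subst_funpow_shift)
qed

text \<open>The word is the concatenation of the blocks \<open>\<tau>\<^sup>k(y)\<close>, where \<open>y\<close> runs over its letters. The
  block with index \<open>m\<close> begins at the 0-based index \<open>block_start k m\<close>, the length of the image
  under \<open>\<tau>\<^sup>k\<close> of the prefix of length \<open>m\<close>.\<close>

definition block_start :: "nat \<Rightarrow> nat \<Rightarrow> nat" where
  "block_start k m = length ((trib_image ^^ k) (trib_prefix m))"

lemma block_start_0: "block_start k 0 = 0"
proof -
  have "(trib_image ^^ k) [] = []" by (induct k) (simp_all add: trib_image_def)
  then show ?thesis by (simp add: block_start_def)
qed

lemma block_start_Suc:
  "block_start k (Suc m) = block_start k m + length ((trib_image ^^ k) [trib_word !! m])"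
  by (simp add: block_start_def stake_Suc trib_image_funpow_append del: stake.simps)

lemma strict_mono_block_start: "strict_mono (block_start k)"
  unfolding strict_mono_Suc_iff
proof
  fix m
  show "block_start k m < block_start k (Suc m)"
    using length_trib_image_funpow[of "[trib_word !! m]" k] by (simp add: block_start_Suc Suc_le_eq)
qed

lemma stake_block:
  assumes "i \<le> length ((trib_image ^^ k) [trib_word !! m])"
  shows "trib_prefix (block_start k m + i)
    = (trib_image ^^ k) (trib_prefix m) @ take i ((trib_image ^^ k) [trib_word !! m])"
proof -
  have "trib_word = ((trib_image ^^ k) (trib_prefix m) @ (trib_image ^^ k) [trib_word !! m]) @-
      (trib_subst ^^ k) (sdrop (Suc m) trib_word)" (is "_ = (?u @ ?v) @- _")
    using trib_word_split[of k "Suc m"] unfolding stake_Suc trib_image_funpow_append .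
  then have "trib_prefix (block_start k m + i) = take (block_start k m + i) (?u @ ?v)"
    using assms by (metis add_left_mono block_start_def length_append stake_shift diff_is_0_eq stake.simps(1) append_Nil2)
  then show ?thesis by (simp add: block_start_def)
qed

lemma snth_block:
  assumes "i < length ((trib_image ^^ k) [trib_word !! m])"
  shows "trib_word !! (block_start k m + i) = (trib_image ^^ k) [trib_word !! m] ! i"
proof -
  have "trib_word = ((trib_image ^^ k) (trib_prefix m) @ (trib_image ^^ k) [trib_word !! m]) @-
      (trib_subst ^^ k) (sdrop (Suc m) trib_word)"
    using trib_word_split[of k "Suc m"] unfolding stake_Suc trib_image_funpow_append .
  then have "trib_word !! (block_start k m + i)
      = ((trib_image ^^ k) (trib_prefix m) @ (trib_image ^^ k) [trib_word !! m]) ! (block_start k m + i)"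
    using assms by (metis add_left_mono nat_add_left_cancel_less block_start_def length_append shift_snth_less)
  then show ?thesis by (simp add: block_start_def nth_append)
qed

lemma block_of_index:
  obtains m i where "n = block_start k m + i" "i < length ((trib_image ^^ k) [trib_word !! m])"
proof -
  have "\<exists>m. block_start k m \<le> n \<and> n < block_start k (Suc m)"
  proof (induct n)
    case 0
    show ?case using strict_monoD[OF strict_mono_block_start, of 0 1 k]
      by (intro exI[of _ 0]) (simp add: block_start_0)
  next
    case (Suc n)
    then obtain m where m: "block_start k m \<le> n" "n < block_start k (Suc m)" by blast
    show ?case
    proof (cases "Suc n < block_start k (Suc m)")
      case True
      then show ?thesis using m by (intro exI[of _ m]) auto
    next
      case False
      then have "Suc n = block_start k (Suc m)" using m by simp
      then show ?thesis
        using strict_monoD[OF strict_mono_block_start, of "Suc m" "Suc (Suc m)" k]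
        by (intro exI[of _ "Suc m"]) auto
    qed
  qed
  then obtain m where m: "block_start k m \<le> n" "n < block_start k (Suc m)" by blast
  show thesis
    by (rule that[of m "n - block_start k m"]) (use m in \<open>auto simp: block_start_Suc\<close>)
qed

text \<open>A prefix ends inside some block \<open>\<tau>(y)\<close>; as \<open>|\<tau>(y)| \<le> 2\<close> and \<open>\<tau>(y)\<close> begins with \<open>a\<close>, at
  most one letter \<open>a\<close> remains after the last complete block.\<close>

lemma trib_prefix_desubst:
  assumes "0 < n"
  obtains m where "m < n" "trib_prefix n = trib_image (trib_prefix m)
    \<or> trib_prefix n = trib_image (trib_prefix m) @ [LetA]"
proof -
  obtain m i where mi: "n = block_start 1 m + i" "i < length ((trib_image ^^ 1) [trib_word !! m])"
    by (rule block_of_index)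
  have p: "trib_prefix n = trib_image (trib_prefix m) @ take i (trib_morph (trib_word !! m))"
    using stake_block[of i 1 m] mi by (simp add: trib_image_def)
  have "take i (trib_morph (trib_word !! m)) = [] \<or> take i (trib_morph (trib_word !! m)) = [LetA]"
    using mi(2) by (cases "trib_word !! m"; cases i) (auto simp: trib_image_def less_Suc_eq)
  moreover have "m < n"
  proof (cases m)
    case (Suc l)
    \<comment> \<open>The first letter of the word is \<open>a\<close>, and \<open>\<tau>(a)\<close> has two letters.\<close>
    have "Suc (Suc (length r)) \<le> length (trib_image (LetA # r))" for r
      using length_trib_image[of r] by (simp add: trib_image_def)
    moreover have "trib_prefix m = LetA # stake l (stl trib_word)"
      using Suc by (simp add: shd_trib_word)
    ultimately have "Suc m \<le> length (trib_image (trib_prefix m))"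
      using Suc by (metis length_Cons length_stake)
    then show ?thesis using mi(1) by (simp add: block_start_def)
  qed (use assms in simp)
  ultimately show thesis using that p by fastforce
qed

section \<open>Positions of the letters\<close>

lemma enumerate_strict_mono_range:
  fixes g :: "nat \<Rightarrow> nat"
  assumes "strict_mono g"
  shows "enumerate (range g) n = g n"
proof (induct n)
  case 0
  show ?case
    by (simp add: enumerate_0) (rule Least_equality, use assms in \<open>auto simp: strict_mono_less_eq\<close>)
next
  case (Suc n)
  have "infinite (range g)"
    using assms by (simp add: range_inj_infinite strict_mono_imp_inj_on)
  then have "enumerate (range g) (Suc n) = (LEAST s. s \<in> range g \<and> g n < s)"
    by (simp add: enumerate_Suc'' Suc)
  also have "\<dots> = g (Suc n)"
    by (rule Least_equality) (use assms in \<open>auto simp: strict_mono_less strict_mono_less_eq\<close>)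
  finally show ?case .
qed

text \<open>If every block \<open>\<tau>\<^sup>k(y)\<close> contains the letter \<open>x\<close> exactly once, always at the 0-based
  index \<open>j\<close>, then the occurrences of \<open>x\<close> correspond to the blocks.\<close>

lemma trib_pos_block:
  assumes "\<And>y i. i < length ((trib_image ^^ k) [y]) \<Longrightarrow> (trib_image ^^ k) [y] ! i = x \<longleftrightarrow> i = j"
    and "\<And>y. j < length ((trib_image ^^ k) [y])"
  shows "trib_pos x (Suc m) = block_start k m + Suc j"
proof -
  have "trib_occ x = range (\<lambda>m. block_start k m + Suc j)"
  proof (intro equalityI subsetI)
    fix p assume "p \<in> trib_occ x"
    then have p: "1 \<le> p" "trib_word !! (p - 1) = x" by (auto simp: trib_occ_def)
    obtain m i where "p - 1 = block_start k m + i" "i < length ((trib_image ^^ k) [trib_word !! m])"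
      by (rule block_of_index)
    moreover from this have "i = j" using p(2) assms(1) by (metis snth_block)
    ultimately have "p = block_start k m + Suc j" using p(1) by simp
    then show "p \<in> range (\<lambda>m. block_start k m + Suc j)" by blast
  next
    fix p assume "p \<in> range (\<lambda>m. block_start k m + Suc j)"
    then show "p \<in> trib_occ x"
      using assms by (auto simp: trib_occ_def snth_block)
  qed
  moreover have "strict_mono (\<lambda>m. block_start k m + Suc j)"
    using strict_mono_block_start by (auto simp: strict_mono_def)
  ultimately show ?thesis
    by (simp add: trib_pos_def enumerate_strict_mono_range)
qed

lemma A_pos_Suc: "A_pos (Suc m) = block_start 1 m + 1"
  and B_pos_Suc: "B_pos (Suc m) = block_start 2 m + 2"
  and C_pos_Suc: "C_pos (Suc m) = block_start 3 m + 4"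
proof -
  have "(trib_image ^^ 1) [y] ! i = LetA \<longleftrightarrow> i = 0"
    if "i < length ((trib_image ^^ 1) [y])" for y i
    using that by (cases y; auto simp: trib_image_def less_Suc_eq)
  moreover have "0 < length ((trib_image ^^ 1) [y])" for y
    by (cases y) (auto simp: trib_image_def)
  ultimately show "A_pos (Suc m) = block_start 1 m + 1"
    using trib_pos_block[of 1 LetA 0 m] by (simp add: A_pos_def)
  have "(trib_image ^^ 2) [y] ! i = LetB \<longleftrightarrow> i = 1"
    if "i < length ((trib_image ^^ 2) [y])" for y i
    using that by (cases y; auto simp: trib_image_def less_Suc_eq numeral_2_eq_2)
  moreover have "1 < length ((trib_image ^^ 2) [y])" for y
    by (cases y) (auto simp: trib_image_def numeral_2_eq_2)
  ultimately show "B_pos (Suc m) = block_start 2 m + 2"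
    using trib_pos_block[of 2 LetB 1 m] by (simp add: B_pos_def)
  have "(trib_image ^^ 3) [y] ! i = LetC \<longleftrightarrow> i = 3"
    if "i < length ((trib_image ^^ 3) [y])" for y i
    using that by (cases y; auto simp: trib_image_def less_Suc_eq numeral_3_eq_3)
  moreover have "3 < length ((trib_image ^^ 3) [y])" for y
    by (cases y) (auto simp: trib_image_def numeral_3_eq_3)
  ultimately show "C_pos (Suc m) = block_start 3 m + 4"
    using trib_pos_block[of 3 LetC 3 m] by (simp add: C_pos_def)
qed

section \<open>Linear functionals of the letter counts\<close>

text \<open>A linear functional \<open>f\<close> of the letter counts is encoded by the sequence \<open>d j = f(\<tau>\<^sup>j(a))\<close>.
  Its first three terms belong to \<open>a\<close>, \<open>ab\<close> and \<open>abac\<close>, which determines the weights of the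
  letters.\<close>

fun letter_wt :: "(nat \<Rightarrow> real) \<Rightarrow> letter \<Rightarrow> real" where
  "letter_wt d LetA = d 0"
| "letter_wt d LetB = d 1 - d 0"
| "letter_wt d LetC = d 2 - d 1 - d 0"

text \<open>For a sequence \<open>d\<close> with the Tribonacci recurrence, which encodes a functional \<open>f\<close>, the number
  \<open>lin d j u\<close> is \<open>f(\<tau>\<^sup>j(u))\<close>: replacing \<open>f\<close> by \<open>f \<circ> \<tau>\<close> shifts the sequence.\<close>

definition lin :: "(nat \<Rightarrow> real) \<Rightarrow> nat \<Rightarrow> letter list \<Rightarrow> real" where
  "lin d j u = (\<Sum>x\<leftarrow>u. letter_wt (\<lambda>i. d (i + j)) x)"

lemma lin_simps: "lin d j [] = 0" "lin d j (u @ v) = lin d j u + lin d j v"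
  "lin d j [LetA] = d j"
  by (simp_all add: lin_def)

lemma lin_trib_image:
  assumes "\<And>j. d (j + 3) = d (j + 2) + d (j + 1) + d j"
  shows "lin d j (trib_image u) = lin d (Suc j) u"
proof (induct u)
  case (Cons x u)
  have "lin d j (trib_morph x) = letter_wt (\<lambda>i. d (i + Suc j)) x"
    using assms[of j] by (cases x) (simp_all add: lin_def numeral_2_eq_2 numeral_3_eq_3)
  moreover have "lin d j (trib_image (x # u)) = lin d j (trib_morph x) + lin d j (trib_image u)"
    by (simp add: trib_image_def lin_simps)
  ultimately show ?case using Cons by (simp add: lin_def)
qed (simp add: lin_def trib_image_def)

lemma lin_trib_image_funpow:
  assumes "\<And>j. d (j + 3) = d (j + 2) + d (j + 1) + d j"
  shows "lin d j ((trib_image ^^ k) u) = lin d (j + k) u"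
  by (induct k arbitrary: j) (simp_all add: lin_trib_image[OF assms])

text \<open>The lengths \<open>|\<tau>\<^sup>j(a)|\<close>, so that this sequence encodes the length functional.\<close>

fun tribo :: "nat \<Rightarrow> nat" where
  "tribo 0 = 1"
| "tribo (Suc 0) = 2"
| "tribo (Suc (Suc 0)) = 4"
| "tribo (Suc (Suc (Suc n))) = tribo (Suc (Suc n)) + tribo (Suc n) + tribo n"

lemma tribo_rec: "tribo (j + 3) = tribo (j + 2) + tribo (j + 1) + tribo j"
  by (simp add: numeral_2_eq_2 numeral_3_eq_3)

lemma length_eq_lin: "real (length u) = lin (\<lambda>i. real (tribo i)) 0 u"
proof (induct u)
  case (Cons x u)
  then show ?case by (cases x) (simp_all add: lin_def numeral_2_eq_2)
qed (simp add: lin_def)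

lemma length_trib_image_funpow_eq_lin:
  "real (length ((trib_image ^^ k) u)) = lin (\<lambda>i. real (tribo i)) k u"
proof -
  have "real (tribo (j + 3)) = real (tribo (j + 2)) + real (tribo (j + 1)) + real (tribo j)" for j
    unfolding tribo_rec by simp
  from lin_trib_image_funpow[OF this, of 0 k u] show ?thesis
    unfolding length_eq_lin by simp
qed

section \<open>Contraction along the morphism\<close>

locale tribonacci_root =
  fixes \<psi> :: real
  assumes root: "\<psi> ^ 3 = \<psi> ^ 2 + \<psi> + 1"
begin

text \<open>The intermediate value theorem yields a root in the stated interval, and the real root is
  unique.\<close>

lemma psi_bounds: "1.83928 \<le> \<psi>" "\<psi> \<le> 1.83929"
proof -
  have "\<exists>x::real. 1.83928 \<le> x \<and> x \<le> 1.83929 \<and> x ^ 3 - x ^ 2 - x - 1 = 0"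
    by (rule IVT) (auto simp: power2_eq_square power3_eq_cube intro!: continuous_intros)
  then obtain x :: real where x: "1.83928 \<le> x" "x \<le> 1.83929" "x ^ 3 = x ^ 2 + x + 1"
    by (auto simp: algebra_simps)
  then have "x = \<psi>" using ex1_real_root root by blast
  then show "1.83928 \<le> \<psi>" "\<psi> \<le> 1.83929" using x by simp_all
qed

lemma psi_pos: "0 < \<psi>" using psi_bounds by simp

lemma psi2_bounds: "3.38295 \<le> \<psi> ^ 2" "\<psi> ^ 2 \<le> 3.38299"
  using power_mono[OF psi_bounds(1), of 2] power_mono[OF psi_bounds(2), of 2] psi_pos
  by (simp_all add: power2_eq_square)

lemma psi3_bounds: "6.22223 \<le> \<psi> ^ 3" "\<psi> ^ 3 \<le> 6.22228"
  using root psi_bounds psi2_bounds by simp_all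

text \<open>The sequence satisfies the recurrence whose characteristic polynomial is
  \<open>x\<^sup>2 + (\<psi> - 1) x + 1/\<psi>\<close>, the cofactor of \<open>x - \<psi>\<close> in \<open>x\<^sup>3 - x\<^sup>2 - x - 1\<close>; the equation is
  multiplied by \<open>\<psi>\<close> to avoid a division.\<close>

definition contracting :: "(nat \<Rightarrow> real) \<Rightarrow> bool" where
  "contracting d \<longleftrightarrow> (\<forall>j. \<psi> * d (j + 2) + (\<psi> ^ 2 - \<psi>) * d (j + 1) + d j = 0)"

text \<open>The quadratic form that the order-two recurrence multiplies by \<open>1/\<psi>\<close>, the product of the two
  conjugate characteristic roots.\<close>

definition qf :: "real \<Rightarrow> real \<Rightarrow> real" where
  "qf x y = x ^ 2 + (\<psi> ^ 2 - \<psi>) * (x * y) + \<psi> * y ^ 2"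

lemma contracting_rec:
  assumes "contracting d"
  shows "d (j + 3) = d (j + 2) + d (j + 1) + d j"
proof -
  have 1: "\<psi> * d (j + 3) + (\<psi> ^ 2 - \<psi>) * d (j + 2) + d (j + 1) = 0"
    using assms[unfolded contracting_def, rule_format, of "Suc j"]
    by (simp add: numeral_2_eq_2 numeral_3_eq_3)
  have 2: "\<psi> * d (j + 2) + (\<psi> ^ 2 - \<psi>) * d (j + 1) + d j = 0"
    using assms by (simp add: contracting_def)
  have "\<psi> * (d (j + 3) - (d (j + 2) + d (j + 1) + d j))
    = (\<psi> * d (j + 3) + (\<psi> ^ 2 - \<psi>) * d (j + 2) + d (j + 1))
      - \<psi> * (\<psi> * d (j + 2) + (\<psi> ^ 2 - \<psi>) * d (j + 1) + d j)
      + (\<psi> ^ 3 - (\<psi> ^ 2 + \<psi> + 1)) * d (j + 1)"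
    by (simp add: algebra_simps power2_eq_square power3_eq_cube)
  also have "\<dots> = 0" using 1 2 root by simp
  finally show ?thesis using psi_pos by simp
qed

lemma contracting_lin:
  assumes "contracting d"
  shows "contracting (\<lambda>j. lin d j u)"
proof (induct u)
  case (Cons x u)
  have "\<psi> * letter_wt (\<lambda>i. d (i + (j + 2))) x + (\<psi> ^ 2 - \<psi>) * letter_wt (\<lambda>i. d (i + (j + 1))) x
      + letter_wt (\<lambda>i. d (i + j)) x = 0" for j
  proof -
    note c = assms[unfolded contracting_def, rule_format]
    show ?thesis
      using c[of j] c[of "j + 1"] c[of "j + 2"]
      by (cases x) (simp_all add: algebra_simps)
  qed
  then show ?case
    using Cons by (simp add: contracting_def lin_def algebra_simps) (smt (verit))
qed (simp add: contracting_def lin_def)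

lemma qf_contract:
  assumes "contracting d"
  shows "qf (d (j + k)) (d (j + k + 1)) = qf (d j) (d (j + 1)) / \<psi> ^ k"
proof (induct k)
  case (Suc k)
  have *: "\<psi> * qf y z = qf x y" if "\<psi> * z + (\<psi> ^ 2 - \<psi>) * y + x = 0" for x y z
  proof -
    have x: "x = - \<psi> * z - (\<psi> ^ 2 - \<psi>) * y" using that by linarith
    show ?thesis unfolding qf_def x by (simp add: algebra_simps power2_eq_square)
  qed
  have "\<psi> * d (j + k + 2) + (\<psi> ^ 2 - \<psi>) * d (j + k + 1) + d (j + k) = 0"
    using assms by (simp add: contracting_def)
  from *[OF this] have "qf (d (j + k + 1)) (d (j + k + 2)) = qf (d (j + k)) (d (j + k + 1)) / \<psi>"
    using psi_pos by (simp add: field_simps)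
  then show ?case using Suc by (simp add: field_simps)
qed simp

lemma qf_lower: "0.6 * x ^ 2 \<le> qf x y"
proof -
  have "(\<psi> ^ 2 - \<psi>) ^ 2 \<le> 1.6 ^ 2"
    using psi_bounds psi2_bounds by (intro power_mono) auto
  then have "(\<psi> ^ 2 - \<psi>) ^ 2 * x ^ 2 \<le> 2.56 * x ^ 2"
    by (intro mult_right_mono) (auto simp: power2_eq_square)
  moreover have "2.56 * x ^ 2 \<le> 4 * \<psi> * 0.4 * x ^ 2"
    using psi_bounds by (intro mult_right_mono) auto
  \<comment> \<open>Completing the square in \<open>y\<close>.\<close>
  moreover have "4 * \<psi> * (qf x y - 0.6 * x ^ 2)
      = (2 * \<psi> * y + (\<psi> ^ 2 - \<psi>) * x) ^ 2 + (4 * \<psi> * 0.4 * x ^ 2 - (\<psi> ^ 2 - \<psi>) ^ 2 * x ^ 2)"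
    by (simp add: qf_def algebra_simps power2_eq_square)
  ultimately have "0 \<le> 4 * \<psi> * (qf x y - 0.6 * x ^ 2)" by simp
  then show ?thesis using psi_pos by (simp add: zero_le_mult_iff)
qed

lemma qf_nonneg: "0 \<le> qf x y"
  using qf_lower[of x y] zero_le_power2[of x] by linarith

text \<open>Peter--Paul inequality: the difference of the two sides is a third of the form at the
  difference of the first vector and three times the second one.\<close>

lemma qf_add: "qf (x + x') (y + y') \<le> 4 / 3 * qf x y + 4 * qf x' y'"
proof -
  have "4 / 3 * qf x y + 4 * qf x' y' - qf (x + x') (y + y') = qf (x - 3 * x') (y - 3 * y') / 3"
    by (simp add: qf_def algebra_simps power2_eq_square)
  then show ?thesis using qf_nonneg[of "x - 3 * x'" "y - 3 * y'"] by linarith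
qed

text \<open>The case \<open>n = 0\<close> is included, with \<open>m = 0\<close> and digit \<open>0\<close>, so that a prefix can be
  desubstituted any number of times.\<close>

lemma lin_trib_prefix_desubst:
  assumes "contracting d"
  obtains m e where "n = 0 \<or> m < n" "e = 0 \<or> e = (1::real)"
    "\<And>j. lin d j (trib_prefix n) = lin d (Suc j) (trib_prefix m) + e * d j"
proof (cases "n = 0")
  case True
  then show thesis by (intro that[of 0 0]) (auto simp: lin_simps)
next
  case False
  then obtain m where m: "m < n" "trib_prefix n = trib_image (trib_prefix m)
    \<or> trib_prefix n = trib_image (trib_prefix m) @ [LetA]"
    using trib_prefix_desubst by blast
  note l = lin_trib_image[of d, OF contracting_rec[OF assms]]
  from m(2) show thesis
    using that[of m 0] that[of m 1] m(1) by (elim disjE) (simp_all add: lin_simps l)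
qed

text \<open>One step of desubstitution turns a bound \<open>R\<close> into \<open>(4/3) R/\<psi> + 8\<close> by \<open>qf_add\<close>, and this is
  at most \<open>R\<close> for \<open>R = 30\<close>.\<close>

lemma qf_lin_trib_prefix:
  assumes "contracting d" "qf (d 0) (d 1) \<le> 2"
  shows "qf (lin d 0 (trib_prefix n)) (lin d 1 (trib_prefix n)) \<le> 30"
proof (induct n rule: less_induct)
  case (less n)
  obtain m e where me: "n = 0 \<or> m < n" "e = 0 \<or> e = (1::real)"
    "\<And>j. lin d j (trib_prefix n) = lin d (Suc j) (trib_prefix m) + e * d j"
    using lin_trib_prefix_desubst[OF assms(1)] by metis
  show ?case
  proof (cases "n = 0")
    case True
    then show ?thesis by (simp add: lin_simps qf_def)
  next
    case False
    then have IH: "qf (lin d 0 (trib_prefix m)) (lin d 1 (trib_prefix m)) \<le> 30"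
      using less me(1) by blast
    have "qf (lin d 1 (trib_prefix m)) (lin d 2 (trib_prefix m)) \<le> 30 / \<psi>"
      using qf_contract[OF contracting_lin[OF assms(1), of "trib_prefix m"], of 0 1] IH psi_pos
      by (simp add: divide_right_mono numeral_2_eq_2)
    also have "\<dots> \<le> 16.5"
      using psi_bounds by (simp add: field_simps)
    finally have 1: "qf (lin d 1 (trib_prefix m)) (lin d 2 (trib_prefix m)) \<le> 16.5" .
    have 2: "qf (e * d 0) (e * d 1) \<le> 2"
      using me(2) assms(2) by (auto simp: qf_def)
    show ?thesis
      using qf_add[of "lin d 1 (trib_prefix m)" "e * d 0" "lin d 2 (trib_prefix m)" "e * d 1"] 1 2
      by (simp add: me(3) numeral_2_eq_2)
  qed
qed

lemma lin_10_trib_prefix: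
  assumes "contracting d" "qf (d 0) (d 1) \<le> 2"
  shows "\<bar>lin d 10 (trib_prefix n)\<bar> \<le> 0.4"
proof -
  let ?l = "\<lambda>j. lin d j (trib_prefix n)"
  have "6 ^ 3 \<le> (\<psi> ^ 3) ^ 3"
    using psi_bounds psi2_bounds root by (intro power_mono) auto
  then have "216 \<le> \<psi> ^ 9" by (simp flip: power_mult)
  then have "216 * 1.8 \<le> \<psi> ^ 9 * \<psi>"
    using psi_bounds by (intro mult_mono) auto
  then have p: "388 \<le> \<psi> ^ 10" by (simp flip: power_Suc2)
  have "qf (?l 10) (?l 11) = qf (?l 0) (?l 1) / \<psi> ^ 10"
    using qf_contract[OF contracting_lin[OF assms(1), of "trib_prefix n"], of 0 10] by simp
  also have "\<dots> \<le> 30 / 388"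
    using qf_lin_trib_prefix[OF assms, of n] p by (intro frac_le) auto
  finally have "(?l 10) ^ 2 \<le> (0.4) ^ 2"
    using qf_lower[of "?l 10" "?l 11"] by (simp add: power2_eq_square)
  then show ?thesis using abs_le_square_iff[of "?l 10" "0.4"] by simp
qed

text \<open>Each of the first ten steps of desubstitution adds \<open>0\<close> or \<open>d j\<close>.\<close>

lemma lin_trib_prefix_bounds:
  assumes "contracting d" "qf (d 0) (d 1) \<le> 2"
    and lo: "a \<le> (\<Sum>j<10. min 0 (d j))" and hi: "(\<Sum>j<10. max 0 (d j)) \<le> b"
  shows "a - 0.4 \<le> lin d 0 (trib_prefix n)" "lin d 0 (trib_prefix n) \<le> b + 0.4"
proof -
  have "- 0.4 + (\<Sum>j=i..<10. min 0 (d j)) \<le> lin d i (trib_prefix n) \<and>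
    lin d i (trib_prefix n) \<le> 0.4 + (\<Sum>j=i..<10. max 0 (d j))" if "i \<le> 10" for i
    using that
  proof (induct i arbitrary: n rule: inc_induct)
    case base
    show ?case using lin_10_trib_prefix[OF assms(1,2), of n] by (simp add: abs_le_iff) linarith
  next
    case (step i)
    obtain m e where me: "e = 0 \<or> e = (1::real)"
      "lin d i (trib_prefix n) = lin d (Suc i) (trib_prefix m) + e * d i"
      using lin_trib_prefix_desubst[OF assms(1)] by metis
    have "min 0 (d i) \<le> e * d i" "e * d i \<le> max 0 (d i)" using me(1) by auto
    then show ?case
      using step(3)[of m] step(2) me(2) by (simp add: sum.atLeast_Suc_lessThan)
  qed
  from this[of 0] have "- 0.4 + (\<Sum>j<10. min 0 (d j)) \<le> lin d 0 (trib_prefix n)"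
    "lin d 0 (trib_prefix n) \<le> 0.4 + (\<Sum>j<10. max 0 (d j))"
    by (simp_all add: atLeast0LessThan)
  with add_left_mono[OF lo, of "- 0.4"] add_left_mono[OF hi, of "0.4"]
  show "a - 0.4 \<le> lin d 0 (trib_prefix n)" "lin d 0 (trib_prefix n) \<le> b + 0.4"
    by linarith+
qed

section \<open>Deviation of the block starts from linear growth\<close>

text \<open>The sequence that encodes the functional \<open>u \<mapsto> |\<tau>\<^sup>k(u)| - \<psi>\<^sup>k |u|\<close>.\<close>

definition drift :: "nat \<Rightarrow> nat \<Rightarrow> real" where
  "drift k j = real (tribo (j + k)) - \<psi> ^ k * real (tribo j)"

lemma lin_drift: "lin (drift k) 0 (trib_prefix n) = real (block_start k n) - \<psi> ^ k * real n"
proof -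
  have "lin (drift k) 0 u = lin (\<lambda>i. real (tribo i)) k u - \<psi> ^ k * lin (\<lambda>i. real (tribo i)) 0 u" for u
  proof (induct u)
    case (Cons x u)
    then show ?case
      by (cases x) (simp_all add: lin_def drift_def algebra_simps)
  qed (simp add: lin_def)
  then show ?thesis
    using length_eq_lin[of "trib_prefix n"]
    by (simp add: block_start_def length_trib_image_funpow_eq_lin)
qed

lemma contracting_drift: "contracting (drift k)"
proof (induct k)
  case 0
  show ?case by (simp add: contracting_def drift_def)
next
  case (Suc k)
  have "contracting (drift 1)"
  proof -
    have "\<psi> * drift 1 (j + 2) + (\<psi> ^ 2 - \<psi>) * drift 1 (j + 1) + drift 1 j
      = - (\<psi> ^ 3 - (\<psi> ^ 2 + \<psi> + 1)) * real (tribo (j + 1))" for j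
      using tribo_rec[of j]
      by (simp add: drift_def algebra_simps power2_eq_square power3_eq_cube numeral_2_eq_2 numeral_3_eq_3)
    then show ?thesis using root by (simp add: contracting_def)
  qed
  then have "\<psi> * drift (Suc k) (j + 2) + (\<psi> ^ 2 - \<psi>) * drift (Suc k) (j + 1) + drift (Suc k) j
    = 0" for j
  proof -
    have a: "\<psi> * drift 1 ((j + k) + 2) + (\<psi> ^ 2 - \<psi>) * drift 1 ((j + k) + 1) + drift 1 (j + k) = 0"
      using \<open>contracting (drift 1)\<close> unfolding contracting_def by blast
    have b: "\<psi> * (\<psi> * drift k (j + 2) + (\<psi> ^ 2 - \<psi>) * drift k (j + 1) + drift k j) = 0"
      using Suc unfolding contracting_def by simp
    \<comment> \<open>Telescoping, with \<open>\<psi> * tribo (i + k)\<close> as the intermediate term.\<close>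
    have "drift (Suc k) i = drift 1 (i + k) + \<psi> * drift k i" for i
      by (simp add: drift_def algebra_simps)
    note this[of "j+2"] this[of "j+1"] this[of j]
    moreover have "j + 2 + k = (j + k) + 2" "j + 1 + k = (j + k) + 1" by simp_all
    ultimately show ?thesis using a b by (simp only:) (simp add: algebra_simps)
  qed
  then show ?case by (simp add: contracting_def)
qed

lemma tribo_values: "tribo 0 = 1" "tribo 1 = 2" "tribo 2 = 4" "tribo 3 = 7" "tribo 4 = 13"
  "tribo 5 = 24" "tribo 6 = 44" "tribo 7 = 81" "tribo 8 = 149" "tribo 9 = 274" "tribo 10 = 504"
  "tribo 11 = 927" "tribo 12 = 1705"
proof -
  show v: "tribo 0 = 1" "tribo 1 = 2" "tribo 2 = 4" by (simp_all add: numeral_2_eq_2)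
  show 3: "tribo 3 = 7" using tribo_rec[of 0] v by simp
  show 4: "tribo 4 = 13" using tribo_rec[of 1] v 3 by simp
  show 5: "tribo 5 = 24" using tribo_rec[of 2] v 3 4 by simp
  show 6: "tribo 6 = 44" using tribo_rec[of 3] 3 4 5 by simp
  show 7: "tribo 7 = 81" using tribo_rec[of 4] 4 5 6 by simp
  show 8: "tribo 8 = 149" using tribo_rec[of 5] 5 6 7 by simp
  show 9: "tribo 9 = 274" using tribo_rec[of 6] 6 7 8 by simp
  show 10: "tribo 10 = 504" using tribo_rec[of 7] 7 8 9 by simp
  show 11: "tribo 11 = 927" using tribo_rec[of 8] 8 9 10 by simp
  show "tribo 12 = 1705" using tribo_rec[of 9] 9 10 11 by simp
qed

lemma sum_upto_10:
  fixes f :: "nat \<Rightarrow> real"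
  shows "(\<Sum>j<10. f j) = f 0 + f 1 + f 2 + f 3 + f 4 + f 5 + f 6 + f 7 + f 8 + f 9"
  by (simp add: eval_nat_numeral)

lemma qf_le:
  assumes "\<bar>x\<bar> \<le> a" "\<bar>y\<bar> \<le> b"
  shows "qf x y \<le> a ^ 2 + 1.55 * (a * b) + 1.84 * b ^ 2"
proof -
  have "x ^ 2 \<le> a ^ 2" "y ^ 2 \<le> b ^ 2"
    using assms by (metis abs_ge_zero power2_abs power_mono)+
  moreover have "x * y \<le> a * b"
  proof -
    have "x * y \<le> \<bar>x\<bar> * \<bar>y\<bar>"
      using abs_ge_self[of "x * y"] by (simp add: abs_mult)
    also have "\<dots> \<le> a * b"
      using assms by (intro mult_mono) auto
    finally show ?thesis .
  qed
  moreover have "(\<psi> ^ 2 - \<psi>) * (x * y) \<le> 1.55 * (a * b)"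
  proof -
    have "(\<psi> ^ 2 - \<psi>) * (x * y) \<le> (\<psi> ^ 2 - \<psi>) * (a * b)"
      using calculation(3) psi_bounds psi2_bounds by (intro mult_left_mono) auto
    also have "\<dots> \<le> 1.55 * (a * b)"
      using assms psi_bounds psi2_bounds by (intro mult_right_mono mult_nonneg_nonneg) auto
    finally show ?thesis .
  qed
  moreover have "\<psi> * y ^ 2 \<le> 1.84 * b ^ 2"
    using calculation(2) psi_bounds by (intro mult_mono) auto
  ultimately show ?thesis by (simp add: qf_def)
qed

text \<open>The numerical data for \<open>k = 1, 2, 3\<close>. The enclosure of \<open>\<psi>\<close> is narrow enough to determine
  the sign of each of the ten terms.\<close>

lemma drift_1_bounds: "qf (drift 1 0) (drift 1 1) \<le> 2"
  "-0.6 \<le> (\<Sum>j<10. min 0 (drift 1 j))" "(\<Sum>j<10. max 0 (drift 1 j)) \<le> 1"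
proof -
  have d: "drift 1 0 = 2 - \<psi>" "drift 1 1 = 4 - 2 * \<psi>" "drift 1 2 = 7 - 4 * \<psi>"
    "drift 1 3 = 13 - 7 * \<psi>" "drift 1 4 = 24 - 13 * \<psi>" "drift 1 5 = 44 - 24 * \<psi>"
    "drift 1 6 = 81 - 44 * \<psi>" "drift 1 7 = 149 - 81 * \<psi>" "drift 1 8 = 274 - 149 * \<psi>"
    "drift 1 9 = 504 - 274 * \<psi>"
    by (simp_all add: drift_def tribo_values)
  have "\<bar>drift 1 0\<bar> \<le> 0.17" "\<bar>drift 1 1\<bar> \<le> 0.33"
    unfolding d abs_le_iff using psi_bounds by simp_all
  from qf_le[OF this] show "qf (drift 1 0) (drift 1 1) \<le> 2"
    by (simp add: power2_eq_square)
  have "0 \<le> drift 1 0" "0 \<le> drift 1 1" "drift 1 2 \<le> 0" "0 \<le> drift 1 3" "0 \<le> drift 1 4"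
    "drift 1 5 \<le> 0" "0 \<le> drift 1 6" "0 \<le> drift 1 7" "drift 1 8 \<le> 0" "0 \<le> drift 1 9"
    unfolding d using psi_bounds by simp_all
  then have "(\<Sum>j<10. min 0 (drift 1 j)) = drift 1 2 + drift 1 5 + drift 1 8"
    "(\<Sum>j<10. max 0 (drift 1 j)) = drift 1 0 + drift 1 1 + drift 1 3 + drift 1 4 + drift 1 6 + drift 1 7 + drift 1 9"
    by (simp_all only: sum_upto_10 min_absorb1 min_absorb2 max_absorb1 max_absorb2 add_0_left add_0_right)
  moreover have "-0.6 \<le> drift 1 2 + drift 1 5 + drift 1 8"
    "drift 1 0 + drift 1 1 + drift 1 3 + drift 1 4 + drift 1 6 + drift 1 7 + drift 1 9 \<le> 1"
    unfolding d using psi_bounds by simp_all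
  ultimately show "-0.6 \<le> (\<Sum>j<10. min 0 (drift 1 j))" "(\<Sum>j<10. max 0 (drift 1 j)) \<le> 1"
    by (simp_all only:)
qed

lemma drift_2_bounds: "qf (drift 2 0) (drift 2 1) \<le> 2"
  "-1 \<le> (\<Sum>j<10. min 0 (drift 2 j))" "(\<Sum>j<10. max 0 (drift 2 j)) \<le> 1.5"
proof -
  have d: "drift 2 0 = 4 - \<psi> ^ 2" "drift 2 1 = 7 - 2 * \<psi> ^ 2" "drift 2 2 = 13 - 4 * \<psi> ^ 2"
    "drift 2 3 = 24 - 7 * \<psi> ^ 2" "drift 2 4 = 44 - 13 * \<psi> ^ 2" "drift 2 5 = 81 - 24 * \<psi> ^ 2"
    "drift 2 6 = 149 - 44 * \<psi> ^ 2" "drift 2 7 = 274 - 81 * \<psi> ^ 2" "drift 2 8 = 504 - 149 * \<psi> ^ 2"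
    "drift 2 9 = 927 - 274 * \<psi> ^ 2"
    by (simp_all add: drift_def tribo_values)
  have "\<bar>drift 2 0\<bar> \<le> 0.62" "\<bar>drift 2 1\<bar> \<le> 0.24"
    unfolding d abs_le_iff using psi2_bounds by simp_all
  from qf_le[OF this] show "qf (drift 2 0) (drift 2 1) \<le> 2"
    by (simp add: power2_eq_square)
  have "0 \<le> drift 2 0" "0 \<le> drift 2 1" "drift 2 2 \<le> 0" "0 \<le> drift 2 3" "0 \<le> drift 2 4"
    "drift 2 5 \<le> 0" "0 \<le> drift 2 6" "drift 2 7 \<le> 0" "drift 2 8 \<le> 0" "0 \<le> drift 2 9"
    unfolding d using psi2_bounds by simp_all
  then have "(\<Sum>j<10. min 0 (drift 2 j)) = drift 2 2 + drift 2 5 + drift 2 7 + drift 2 8"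
    "(\<Sum>j<10. max 0 (drift 2 j)) = drift 2 0 + drift 2 1 + drift 2 3 + drift 2 4 + drift 2 6 + drift 2 9"
    by (simp_all only: sum_upto_10 min_absorb1 min_absorb2 max_absorb1 max_absorb2 add_0_left add_0_right)
  moreover have "-1 \<le> drift 2 2 + drift 2 5 + drift 2 7 + drift 2 8"
    "drift 2 0 + drift 2 1 + drift 2 3 + drift 2 4 + drift 2 6 + drift 2 9 \<le> 1.5"
    unfolding d using psi2_bounds by simp_all
  ultimately show "-1 \<le> (\<Sum>j<10. min 0 (drift 2 j))" "(\<Sum>j<10. max 0 (drift 2 j)) \<le> 1.5"
    by (simp_all only:)
qed

lemma drift_3_bounds: "qf (drift 3 0) (drift 3 1) \<le> 2"
  "-1.35 \<le> (\<Sum>j<10. min 0 (drift 3 j))" "(\<Sum>j<10. max 0 (drift 3 j)) \<le> 2.5"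
proof -
  have d: "drift 3 0 = 7 - \<psi> ^ 3" "drift 3 1 = 13 - 2 * \<psi> ^ 3" "drift 3 2 = 24 - 4 * \<psi> ^ 3"
    "drift 3 3 = 44 - 7 * \<psi> ^ 3" "drift 3 4 = 81 - 13 * \<psi> ^ 3" "drift 3 5 = 149 - 24 * \<psi> ^ 3"
    "drift 3 6 = 274 - 44 * \<psi> ^ 3" "drift 3 7 = 504 - 81 * \<psi> ^ 3" "drift 3 8 = 927 - 149 * \<psi> ^ 3"
    "drift 3 9 = 1705 - 274 * \<psi> ^ 3"
    by (simp_all add: drift_def tribo_values)
  have "\<bar>drift 3 0\<bar> \<le> 0.78" "\<bar>drift 3 1\<bar> \<le> 0.56"
    unfolding d abs_le_iff using psi3_bounds by simp_all
  from qf_le[OF this] show "qf (drift 3 0) (drift 3 1) \<le> 2"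
    by (simp add: power2_eq_square)
  have "0 \<le> drift 3 0" "0 \<le> drift 3 1" "drift 3 2 \<le> 0" "0 \<le> drift 3 3" "0 \<le> drift 3 4"
    "drift 3 5 \<le> 0" "0 \<le> drift 3 6" "drift 3 7 \<le> 0" "drift 3 8 \<le> 0" "0 \<le> drift 3 9"
    unfolding d using psi3_bounds by simp_all
  then have "(\<Sum>j<10. min 0 (drift 3 j)) = drift 3 2 + drift 3 5 + drift 3 7 + drift 3 8"
    "(\<Sum>j<10. max 0 (drift 3 j)) = drift 3 0 + drift 3 1 + drift 3 3 + drift 3 4 + drift 3 6 + drift 3 9"
    by (simp_all only: sum_upto_10 min_absorb1 min_absorb2 max_absorb1 max_absorb2 add_0_left add_0_right)
  moreover have "-1.35 \<le> drift 3 2 + drift 3 5 + drift 3 7 + drift 3 8"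
    "drift 3 0 + drift 3 1 + drift 3 3 + drift 3 4 + drift 3 6 + drift 3 9 \<le> 2.5"
    unfolding d using psi3_bounds by simp_all
  ultimately show "-1.35 \<le> (\<Sum>j<10. min 0 (drift 3 j))" "(\<Sum>j<10. max 0 (drift 3 j)) \<le> 2.5"
    by (simp_all only:)
qed

lemma block_start_bounds:
  "- 1 \<le> real (block_start 1 n) - \<psi> * real n" "real (block_start 1 n) - \<psi> * real n \<le> 1.4"
  "- 1.4 \<le> real (block_start 2 n) - \<psi> ^ 2 * real n" "real (block_start 2 n) - \<psi> ^ 2 * real n \<le> 1.9"
  "- 1.75 \<le> real (block_start 3 n) - \<psi> ^ 3 * real n" "real (block_start 3 n) - \<psi> ^ 3 * real n \<le> 2.9"
  using lin_trib_prefix_bounds[OF contracting_drift drift_1_bounds, of n]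
    lin_trib_prefix_bounds[OF contracting_drift drift_2_bounds, of n]
    lin_trib_prefix_bounds[OF contracting_drift drift_3_bounds, of n]
  by (simp_all add: lin_drift)

end

theorem theorem16:
  fixes \<psi> :: real and n :: nat
  assumes "\<psi> ^ 3 = \<psi> ^ 2 + \<psi> + 1"
  shows "(\<lfloor>\<psi> * real n\<rfloor> - 1 \<le> int (A_pos n) \<and> int (A_pos n) \<le> \<lfloor>\<psi> * real n\<rfloor> + 1) \<and>
    (\<lfloor>\<psi> ^ 2 * real n\<rfloor> - 2 \<le> int (B_pos n) \<and> int (B_pos n) \<le> \<lfloor>\<psi> ^ 2 * real n\<rfloor> + 1) \<and>
    (\<lfloor>\<psi> ^ 3 * real n\<rfloor> - 3 \<le> int (C_pos n) \<and> int (C_pos n) \<le> \<lfloor>\<psi> ^ 3 * real n\<rfloor> + 1)"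
proof (cases n)
  case 0
  then show ?thesis by (simp add: A_pos_def B_pos_def C_pos_def trib_pos_def)
next
  case (Suc m)
  interpret tribonacci_root \<psi> by unfold_locales (rule assms)
  \<comment> \<open>The floor inequalities as bounds on the real number, strict on one side.\<close>
  have *: "\<lfloor>x\<rfloor> - r \<le> int p \<and> int p \<le> \<lfloor>x\<rfloor> + 1"
    if "x < real p + of_int r + 1" "real p \<le> x + 1" for x r p
    using that by linarith
  note b = block_start_bounds[of m] psi_bounds psi2_bounds
  show ?thesis
    unfolding Suc A_pos_Suc B_pos_Suc C_pos_Suc
    by (intro conjI[OF * conjI[OF * *]])
      (use b root in \<open>simp_all add: algebra_simps\<close>)
qed

end
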